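(* Let $G$ be a connected graph on $n \geq 2$ vertices. Then $\mathcal{D}(G)$ is Eulerian if and only if $n$ is even and $G$ is the cocktail party graph on $n \geq 4$ vertices.
   Context: All graphs are finite and simple. A dominating set of a graph $G$ is a set $D \subseteq V(G)$ such that every vertex of $V(G)\setminus D$ is adjacent to a vertex of $D$. The dominating graph $\mathcal{D}(G)$ is the graph whose vertices are all the dominating sets of $G$ (of any cardinality), two of them being adjacent if and only if one can be obtained from the other by adding or removing a single vertex of $G$. A graph is Eulerian if and only if every vertex has even degree and it contains at most one non-trivial component (a graph or component is trivial if it contains no edges). For an even integer $n \geq 4$, the cocktail party graph on $n$ vertices is the graph obtained by removing a perfect matching from the complete graph $K_n$ (identification of graphs is up to isomorphism). *)

theory Defs
  imports "Graph_Theory.Graph_Theory"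
begin

text \<open>
  Finite simple graphs are \<open>pair_graph\<close>s, i.e. finite loop-free symmetric digraphs whose arcs are
  pairs of vertices; an undirected edge is represented by its two opposite arcs.
\<close>

definition dominating_set :: "'a pair_pre_digraph \<Rightarrow> 'a set \<Rightarrow> bool" where
  "dominating_set G D \<longleftrightarrow>
     D \<subseteq> pverts G \<and> (\<forall>v \<in> pverts G - D. \<exists>u \<in> D. (v, u) \<in> parcs G)"

definition dominating_graph :: "'a pair_pre_digraph \<Rightarrow> 'a set pair_pre_digraph" where
  "dominating_graph G =
     \<lparr> pverts = {D. dominating_set G D},
       parcs = {(D, D'). dominating_set G D \<and> dominating_set G D' \<and>
                  (\<exists>v \<in> pverts G. v \<notin> D \<and> D' = insert v D \<or> v \<in> D \<and> D' = D - {v})} \<rparr>"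

lemma pair_graph_dominating_graph:
  assumes "pair_graph G"
  shows "pair_graph (dominating_graph G)"
proof -
  interpret pair_graph G by (rule assms)
  have fin: "finite {D. dominating_set G D}"
    by (rule finite_subset[of _ "Pow (pverts G)"]) (auto simp: dominating_set_def)
  have "parcs (dominating_graph G) \<subseteq> {D. dominating_set G D} \<times> {D. dominating_set G D}"
    by (auto simp: dominating_graph_def)
  then have "finite (parcs (dominating_graph G))"
    by (rule finite_subset) (intro finite_cartesian_product fin)
  moreover have "finite (pverts (dominating_graph G))"
    using fin by (simp add: dominating_graph_def)
  moreover have "symmetric (with_proj (dominating_graph G))"
    by (auto simp: dominating_graph_def symmetric_def insert_absorb intro!: symI)
  moreover have "fst e \<in> pverts (dominating_graph G)" "snd e \<in> pverts (dominating_graph G)"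
      "fst e \<noteq> snd e" if "e \<in> parcs (dominating_graph G)" for e
    using that by (auto simp: dominating_graph_def)
  ultimately show ?thesis
    by unfold_locales auto
qed

definition component :: "('a, 'b) pre_digraph \<Rightarrow> ('a, 'b) pre_digraph \<Rightarrow> bool" where
  "component G C \<longleftrightarrow> pre_digraph.max_subgraph G connected C"

text \<open>
  Intended for graphs, where each edge at \<open>v\<close> contributes exactly one arc leaving \<open>v\<close>, so that
  \<^const>\<open>out_degree\<close> is the undirected degree.
\<close>

definition eulerian :: "('a, 'b) pre_digraph \<Rightarrow> bool" where
  "eulerian G \<longleftrightarrow>
     (\<forall>v \<in> verts G. even (out_degree G v)) \<and>
     (\<forall>C C'. component G C \<and> arcs C \<noteq> {} \<and> component G C' \<and> arcs C' \<noteq> {} \<longrightarrow> C = C')"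

text \<open>A matching is given by its symmetric set of arcs.\<close>

definition perfect_matching :: "'a pair_pre_digraph \<Rightarrow> ('a \<times> 'a) set \<Rightarrow> bool" where
  "perfect_matching G M \<longleftrightarrow>
     M \<subseteq> parcs G \<and> sym M \<and> (\<forall>v \<in> pverts G. \<exists>!w. (v, w) \<in> M)"

definition cocktail_party_graph :: "nat \<Rightarrow> 'a pair_pre_digraph \<Rightarrow> bool" where
  "cocktail_party_graph n G \<longleftrightarrow>
     even n \<and> n \<ge> 4 \<and>
     (\<exists>(K :: nat pair_pre_digraph) M.
        complete_digraph n (with_proj K) \<and> perfect_matching K M \<and>
        digraph_iso (with_proj \<lparr> pverts = pverts K, parcs = parcs K - M \<rparr>) (with_proj G))"

end

theory Submission
  imports Defs
begin

text \<open>
  From a dominating set one can always climb to the full vertex set, so \<open>\<D>(G)\<close> is connected and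
  only the parity of its degrees matters. The degree of \<open>D\<close> is \<open>n\<close> minus the number of critical
  vertices of \<open>D\<close>, those whose removal destroys domination. The full vertex set has no critical
  vertex, so \<open>n\<close> must be even, and then every dominating set must have an even number of critical
  vertices. Take \<open>v\<close> of minimum degree and \<open>u \<in> N[v]\<close>. The complement of \<open>N[v] - {u}\<close> is dominating
  and \<open>u\<close> is critical in it, so there is a second critical vertex \<open>x\<close>, and minimality forces
  \<open>N[w] = N[v] - {u} \<union> {x}\<close> for some \<open>w\<close>. For \<open>u = v\<close> this gives a twin \<open>z = w\<close> of \<open>v\<close>; for
  \<open>u \<noteq> v\<close> the map \<open>u \<mapsto> w\<close> permutes the neighbours of \<open>v\<close>, so every neighbour of \<open>v\<close>
  misses exactly one vertex of \<open>N[v]\<close> and has \<open>z\<close> as its only neighbour outside. By connectedness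
  \<open>N[v] \<union> {z}\<close> is everything.
\<close>

section \<open>Closed neighbourhoods and domination\<close>

definition closed_nbhd :: "'a pair_pre_digraph \<Rightarrow> 'a \<Rightarrow> 'a set" where
  "closed_nbhd G v = insert v {w. (v, w) \<in> parcs G}"

definition critical :: "'a pair_pre_digraph \<Rightarrow> 'a set \<Rightarrow> 'a set" where
  "critical G D = {x \<in> D. \<not> dominating_set G (D - {x})}"

text \<open>As \<open>a\<close> lies in its own closed neighbourhood, \<open>b\<close> differs from
  \<open>a\<close>. In a \<open>pair_graph\<close>, symmetry then makes the non-edges a perfect
  matching, so this is the cocktail party condition without an isomorphism.\<close>

definition unique_non_neighbours :: "'a pair_pre_digraph \<Rightarrow> bool" where
  "unique_non_neighbours G \<longleftrightarrow>
     (\<forall>a \<in> pverts G. \<exists>b \<in> pverts G. closed_nbhd G a = pverts G - {b})"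

lemma self_in_closed_nbhd [simp]: "v \<in> closed_nbhd G v"
  by (simp add: closed_nbhd_def)

lemma critical_subset: "critical G D \<subseteq> D"
  by (auto simp: critical_def)

lemma dominating_set_insert:
  assumes "dominating_set G D" "v \<in> pverts G"
  shows "dominating_set G (insert v D)"
  using assms by (auto simp: dominating_set_def)

lemma dominating_set_verts: "dominating_set G (pverts G)"
  by (simp add: dominating_set_def)

context pair_graph
begin

lemma closed_nbhd_sym: "w \<in> closed_nbhd G v \<longleftrightarrow> v \<in> closed_nbhd G w"
  using arcs_symmetric by (auto simp: closed_nbhd_def)

lemma closed_nbhd_subset: "v \<in> pverts G \<Longrightarrow> closed_nbhd G v \<subseteq> pverts G"
  using in_arcsD2 by (auto simp: closed_nbhd_def)

lemma finite_closed_nbhd: "v \<in> pverts G \<Longrightarrow> finite (closed_nbhd G v)"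
  using closed_nbhd_subset pair_finite_verts finite_subset by blast

lemma dominating_set_iff_closed_nbhd:
  "dominating_set G D \<longleftrightarrow> D \<subseteq> pverts G \<and> (\<forall>v \<in> pverts G. closed_nbhd G v \<inter> D \<noteq> {})"
  by (fastforce simp: dominating_set_def closed_nbhd_def)

text \<open>Shrinking a dominating set enlarges its complement \<open>T\<close>, so criticality
  becomes the question which closed neighbourhoods fit into \<open>T\<close> with one more
  vertex.\<close>

lemma dominating_set_Diff_iff:
  "dominating_set G (pverts G - T) \<longleftrightarrow> (\<forall>v \<in> pverts G. \<not> closed_nbhd G v \<subseteq> T)"
  unfolding dominating_set_iff_closed_nbhd using closed_nbhd_subset by blast

text \<open>Connectedness of a symmetric digraph gives a directed path from \<open>a\<close> to any
  vertex, and membership in \<open>S\<close> spreads along it.\<close>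

lemma connected_closed_set_eq_verts:
  assumes conn: "connected (with_proj G)" and "a \<in> S" "S \<subseteq> pverts G"
    and closed: "\<And>x. x \<in> S \<Longrightarrow> closed_nbhd G x \<subseteq> S"
  shows "S = pverts G"
proof
  show "pverts G \<subseteq> S"
  proof
    fix b assume "b \<in> pverts G"
    moreover have "strongly_connected (with_proj G)"
      using symmetric_connected_imp_strongly_connected[OF sym_arcs conn] .
    ultimately have "a \<rightarrow>\<^sup>*\<^bsub>with_proj G\<^esub> b"
      using assms by (auto simp: strongly_connected_def)
    then show "b \<in> S"
    proof (induction rule: reachable_induct)
      case base show ?case by fact
    next
      case (step x y)
      then show ?case using closed[of x] by (auto simp: closed_nbhd_def)
    qed
  qed
qed fact

lemma connected_imp_closed_nbhd_ne_singleton: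
  assumes "connected (with_proj G)" "card (pverts G) \<ge> 2" "w \<in> pverts G"
  shows "closed_nbhd G w \<noteq> {w}"
proof
  assume "closed_nbhd G w = {w}"
  then have "{w} = pverts G"
    using assms by (intro connected_closed_set_eq_verts[of w]) auto
  then have "card (pverts G) = card {w}" by simp
  then show False using assms by simp
qed

section \<open>Connectedness and degrees of the dominating graph\<close>

lemma connected_dominating_graph: "connected (with_proj (dominating_graph G))"
proof -
  interpret DG: pair_graph "dominating_graph G"
    by (rule pair_graph_dominating_graph) (rule pair_graph)
  have up: "D \<rightarrow>\<^sup>*\<^bsub>with_proj (dominating_graph G)\<^esub> pverts G" if "dominating_set G D" for D
    using that
  proof (induction "card (pverts G - D)" arbitrary: D)
    case 0
    then have "D = pverts G"
      using pair_finite_verts by (auto simp: dominating_set_def)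
    then show ?case
      using DG.reachable_refl[of "pverts G"] dominating_set_verts[of G]
      by (simp add: dominating_graph_def)
  next
    case (Suc k)
    then obtain v where v: "v \<in> pverts G" "v \<notin> D"
      by (metis Diff_iff card_eq_0_iff ex_in_conv nat.distinct(1))
    then have "card (pverts G - insert v D) = k"
      using Suc(2) pair_finite_verts by (simp add: Diff_insert[of _ v D])
    moreover have ins: "dominating_set G (insert v D)"
      using Suc.prems v by (simp add: dominating_set_insert)
    ultimately have "insert v D \<rightarrow>\<^sup>*\<^bsub>with_proj (dominating_graph G)\<^esub> pverts G"
      using Suc(1) by blast
    moreover have "(D, insert v D) \<in> parcs (dominating_graph G)"
      using Suc.prems ins v by (auto simp: dominating_graph_def)
    ultimately show ?case
      by (simp add: DG.adj_reachable_trans)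
  qed
  have "strongly_connected (with_proj (dominating_graph G))"
  proof
    show "verts (with_proj (dominating_graph G)) \<noteq> {}"
      using dominating_set_verts[of G] by (auto simp: dominating_graph_def)
  next
    fix D E
    assume "D \<in> verts (with_proj (dominating_graph G))" "E \<in> verts (with_proj (dominating_graph G))"
    then have "D \<rightarrow>\<^sup>*\<^bsub>with_proj (dominating_graph G)\<^esub> pverts G"
        "E \<rightarrow>\<^sup>*\<^bsub>with_proj (dominating_graph G)\<^esub> pverts G"
      using up by (auto simp: dominating_graph_def)
    \<comment> \<open>Climb from \<open>D\<close> to the full vertex set, then descend to
      \<open>E\<close> along a reversed path.\<close>
    then show "D \<rightarrow>\<^sup>*\<^bsub>with_proj (dominating_graph G)\<^esub> E"
      using DG.symmetric_reachable' DG.reachable_trans by blast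
  qed
  then show ?thesis
    unfolding connected_def strongly_connected_def
    using DG.reachable_mk_symmetricI by (auto simp: mk_symmetric_def)
qed

text \<open>A connected graph is a connected subgraph of itself lying above all others, so
  maximality leaves no other component. This settles the second clause of \<open>eulerian\<close>
  for the dominating graph.\<close>

lemma component_connected_eq:
  assumes "connected (with_proj G)" "component (with_proj G) C"
  shows "C = with_proj G"
proof -
  have "subgraph C (with_proj G)" "subgraph (with_proj G) (with_proj G)"
    using assms(2) by (auto simp: component_def max_subgraph_def subgraph_def compatible_def)
  then show ?thesis
    using assms by (auto simp: component_def max_subgraph_def)
qed

text \<open>Toggling a vertex leads to a neighbour of \<open>D\<close> unless the vertex is
  critical, because insertion always preserves domination. The sum form avoids subtraction on
  naturals, so parities can be compared directly.\<close>

lemma out_degree_dominating_graph: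
  assumes D: "dominating_set G D"
  shows "out_degree (with_proj (dominating_graph G)) D + card (critical G D) = card (pverts G)"
proof -
  let ?f = "\<lambda>x. (D, if x \<in> D then D - {x} else insert x D)"
  have sub: "D \<subseteq> pverts G" using D by (simp add: dominating_set_def)
  have "out_arcs (with_proj (dominating_graph G)) D = ?f ` (pverts G - critical G D)"
  proof (intro equalityI subsetI)
    fix e assume "e \<in> out_arcs (with_proj (dominating_graph G)) D"
    then obtain v where v: "v \<in> pverts G" "e = ?f v" "dominating_set G (snd e)"
      by (auto simp: dominating_graph_def)
    moreover from v have "v \<notin> critical G D"
      by (auto simp: critical_def)
    ultimately show "e \<in> ?f ` (pverts G - critical G D)" by blast
  next
    fix e assume "e \<in> ?f ` (pverts G - critical G D)"
    then obtain v where v: "v \<in> pverts G" "v \<notin> critical G D" "e = ?f v" by blast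
    then have "dominating_set G (snd e)"
      using D dominating_set_insert[OF D] by (auto simp: critical_def)
    then show "e \<in> out_arcs (with_proj (dominating_graph G)) D"
      using D v by (auto simp: dominating_graph_def)
  qed
  \<comment> \<open>The toggled vertex is the only one in which \<open>D\<close> and the new set
    differ.\<close>
  moreover have "inj_on ?f (pverts G - critical G D)"
    by (auto intro!: inj_onI split: if_splits)
  ultimately have "out_degree (with_proj (dominating_graph G)) D = card (pverts G - critical G D)"
    by (simp add: out_degree_def card_image)
  moreover have "critical G D \<subseteq> pverts G"
    using critical_subset[of G D] sub by (rule subset_trans)
  then have "card (pverts G - critical G D) + card (critical G D) = card (pverts G)"
    using pair_finite_verts by (metis card_Diff_subset card_mono finite_subset le_add_diff_inverse2)
  ultimately show ?thesis by simp
qed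

lemma eulerian_dominating_graph_iff:
  "eulerian (with_proj (dominating_graph G)) \<longleftrightarrow>
     (\<forall>D. dominating_set G D \<longrightarrow> (even (card (critical G D)) \<longleftrightarrow> even (card (pverts G))))"
proof -
  interpret DG: pair_graph "dominating_graph G"
    by (rule pair_graph_dominating_graph) (rule pair_graph)
  have verts: "pverts (dominating_graph G) = {D. dominating_set G D}"
    by (simp add: dominating_graph_def)
  have degree_parity: "even (out_degree (with_proj (dominating_graph G)) D) \<longleftrightarrow>
      (even (card (critical G D)) \<longleftrightarrow> even (card (pverts G)))" if "dominating_set G D" for D
    unfolding out_degree_dominating_graph[OF that, symmetric] by auto
  have "eulerian (with_proj (dominating_graph G)) \<longleftrightarrow>
      (\<forall>D \<in> pverts (dominating_graph G). even (out_degree (with_proj (dominating_graph G)) D))"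
    using DG.component_connected_eq[OF connected_dominating_graph] by (auto simp: eulerian_def)
  also have "\<dots> \<longleftrightarrow>
      (\<forall>D. dominating_set G D \<longrightarrow> (even (card (critical G D)) \<longleftrightarrow> even (card (pverts G))))"
    using degree_parity by (simp add: verts)
  finally show ?thesis .
qed

text \<open>No closed neighbourhood is a singleton, so all of them survive the loss of one vertex.
  At the full vertex set the parity condition therefore makes the order even.\<close>

lemma critical_verts_eq_empty:
  assumes "connected (with_proj G)" "card (pverts G) \<ge> 2"
  shows "critical G (pverts G) = {}"
proof -
  have "\<not> closed_nbhd G w \<subseteq> {x}" if "w \<in> pverts G" for w x
    using connected_imp_closed_nbhd_ne_singleton[OF assms that] self_in_closed_nbhd[of w G]
    by blast
  then show ?thesis
    unfolding critical_def dominating_set_Diff_iff by blast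
qed

section \<open>Even critical sets force unique non-neighbours\<close>

lemma min_degree_exchange:
  assumes v: "v \<in> pverts G"
    and min: "\<And>w. w \<in> pverts G \<Longrightarrow> card (closed_nbhd G v) \<le> card (closed_nbhd G w)"
    and u: "u \<in> closed_nbhd G v"
    and even_critical: "\<And>D. dominating_set G D \<Longrightarrow> even (card (critical G D))"
  obtains x w where "x \<notin> closed_nbhd G v" "w \<in> pverts G"
    "closed_nbhd G w = insert x (closed_nbhd G v - {u})"
proof -
  define T where "T = closed_nbhd G v - {u}"
  note fin = finite_closed_nbhd[OF v]
  have finT: "finite T" and cardT: "card (closed_nbhd G v) = Suc (card T)"
    using fin u by (auto simp: T_def card_Suc_Diff1 simp del: card_Diff_insert)
  \<comment> \<open>\<open>T\<close> is one vertex smaller than the smallest closed neighbourhood,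
    so it contains none.\<close>
  have dom: "dominating_set G (pverts G - T)"
    unfolding dominating_set_Diff_iff
  proof (intro ballI notI)
    fix w assume "w \<in> pverts G" "closed_nbhd G w \<subseteq> T"
    then show False using card_mono[OF finT, of "closed_nbhd G w"] min[of w] cardT by simp
  qed
  have crit_iff: "x \<in> critical G (pverts G - T) \<longleftrightarrow>
      x \<in> pverts G - T \<and> (\<exists>w \<in> pverts G. closed_nbhd G w \<subseteq> insert x T)" for x
    using dominating_set_Diff_iff[of "insert x T"]
    by (auto simp: critical_def Diff_insert[symmetric])
  \<comment> \<open>Putting \<open>u\<close> back into \<open>T\<close> completes the closed
    neighbourhood of \<open>v\<close> itself.\<close>
  have "u \<in> critical G (pverts G - T)"
    unfolding crit_iff using u v closed_nbhd_subset[OF v] by (auto simp: T_def)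
  moreover have "critical G (pverts G - T) \<noteq> {u}"
    using even_critical[OF dom] by auto
  ultimately obtain x where "x \<in> critical G (pverts G - T)" "x \<noteq> u" by blast
  then obtain w where x: "x \<notin> T" and w: "w \<in> pverts G" "closed_nbhd G w \<subseteq> insert x T"
    using crit_iff by blast
  \<comment> \<open>By minimality the left side has at least \<open>Suc (card T)\<close> elements,
    which is all that the right side has.\<close>
  have "closed_nbhd G w = insert x T"
    using w x finT min[OF w(1)] cardT by (intro card_seteq) auto
  moreover have "x \<notin> closed_nbhd G v"
    using x \<open>x \<noteq> u\<close> by (simp add: T_def)
  ultimately show thesis using that w(1) by (simp add: T_def)
qed

lemma unique_non_neighbours_if_even_critical:
  assumes conn: "connected (with_proj G)"
    and even_critical: "\<And>D. dominating_set G D \<Longrightarrow> even (card (critical G D))"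
  shows "unique_non_neighbours G"
proof -
  let ?N = "closed_nbhd G"
  have "pverts G \<noteq> {}"
    using conn by (auto simp: connected_conv)
  then obtain v where v: "v \<in> pverts G"
    and min: "\<And>w. w \<in> pverts G \<Longrightarrow> card (?N v) \<le> card (?N w)"
    using ex_min_if_finite[of "(\<lambda>w. card (?N w)) ` pverts G"] pair_finite_verts
    by (auto simp: not_less)
  have "\<forall>u. \<exists>x w. u \<in> ?N v \<longrightarrow>
      x \<notin> ?N v \<and> w \<in> pverts G \<and> ?N w = insert x (?N v - {u})"
    using min_degree_exchange[OF v min _ even_critical] by metis
  then obtain x w where xw: "\<And>u. u \<in> ?N v \<Longrightarrow> x u \<notin> ?N v"
      "\<And>u. u \<in> ?N v \<Longrightarrow> w u \<in> pverts G"
      "\<And>u. u \<in> ?N v \<Longrightarrow> ?N (w u) = insert (x u) (?N v - {u})"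
    by metis
  define z where "z = w v"
  have u_notin: "u \<notin> ?N (w u)" if "u \<in> ?N v" for u
    using xw(1,3)[OF that] that by auto
  have "z \<notin> ?N v"
    using u_notin[of v] closed_nbhd_sym[of z v] by (simp add: z_def)
  have "z = x v"
    using xw(3)[of v] self_in_closed_nbhd[of "w v" G] \<open>z \<notin> ?N v\<close> by (auto simp: z_def)
  have z: "z \<in> pverts G" "?N z = insert z (?N v - {v})"
    using xw(2,3)[of v] \<open>z = x v\<close> by (auto simp: z_def)
  \<comment> \<open>If \<open>w\<close> agreed on \<open>u\<close> and a different
    \<open>u'\<close>, then \<open>u'\<close> would survive in the closed neighbourhood of
    \<open>w u\<close>, which drops only \<open>u\<close>, yet be missing from that of
    \<open>w u'\<close>.\<close>
  have inj: "inj_on w (?N v - {v})"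
    using u_notin xw(3) by (intro inj_onI) (metis Diff_iff insertCI singletonD)
  \<comment> \<open>The exchange for \<open>u\<close> keeps \<open>v\<close>, so \<open>w u\<close>
    is in the closed neighbourhood of \<open>v\<close>; it is not \<open>v\<close>, whose closed
    neighbourhood contains \<open>u\<close>.\<close>
  have "w ` (?N v - {v}) \<subseteq> ?N v - {v}"
  proof (rule image_subsetI)
    fix u assume "u \<in> ?N v - {v}"
    then have u: "u \<in> ?N v" "u \<noteq> v" by simp_all
    then have "v \<in> ?N (w u)" using xw(3) by simp
    moreover have "w u \<noteq> v" using u_notin u by auto
    ultimately show "w u \<in> ?N v - {v}" using closed_nbhd_sym by simp
  qed
  then have surj: "w ` (?N v - {v}) = ?N v - {v}"
    using inj finite_closed_nbhd[OF v] by (intro endo_inj_surj) auto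
  have nb: "\<exists>u \<in> ?N v - {v}. ?N y = insert z (?N v - {u})" if y: "y \<in> ?N v - {v}" for y
  proof -
    obtain u where u: "u \<in> ?N v - {v}" "y = w u" using y surj by blast
    have "z \<in> ?N y" using z(2) y closed_nbhd_sym by blast
    \<comment> \<open>\<open>x u\<close> is the only vertex of the closed neighbourhood of
      \<open>w u\<close> outside that of \<open>v\<close>, so the same \<open>z\<close> enters in
      every exchange.\<close>
    then have "z = x u" using u xw(3) \<open>z \<notin> ?N v\<close> by auto
    then show ?thesis using u xw(3) by blast
  qed
  have "insert z (?N v) = pverts G"
  proof (rule connected_closed_set_eq_verts[OF conn])
    show "v \<in> insert z (?N v)" by simp
    show "insert z (?N v) \<subseteq> pverts G" using z closed_nbhd_subset[OF v] by blast
    show "?N y \<subseteq> insert z (?N v)" if "y \<in> insert z (?N v)" for y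
      using that z(2) nb by blast
  qed
  then have verts: "pverts G = insert z (?N v)" by simp
  show ?thesis
    unfolding unique_non_neighbours_def
  proof
    fix a assume "a \<in> pverts G"
    then consider "a = v" | "a = z" | "a \<in> ?N v - {v}" using verts by blast
    then show "\<exists>b \<in> pverts G. ?N a = pverts G - {b}"
    proof cases
      case 1
      then have "?N a = pverts G - {z}" using verts \<open>z \<notin> ?N v\<close> by blast
      then show ?thesis using z(1) by blast
    next
      case 2
      have "?N a = pverts G - {v}"
        using 2 z(2) verts \<open>z \<notin> ?N v\<close> self_in_closed_nbhd[of v G] by auto
      then show ?thesis using v by blast
    next
      case 3
      then obtain u where "u \<in> ?N v - {v}" "?N a = insert z (?N v - {u})" using nb by blast
      then have "?N a = pverts G - {u}" "u \<in> pverts G" using verts \<open>z \<notin> ?N v\<close> by auto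
      then show ?thesis by blast
    qed
  qed
qed

section \<open>Critical vertices in a graph with unique non-neighbours\<close>

lemma dominating_set_iff_card_ge_2:
  assumes unique: "unique_non_neighbours G" and ne: "pverts G \<noteq> {}"
  shows "dominating_set G D \<longleftrightarrow> D \<subseteq> pverts G \<and> card D \<ge> 2"
proof (cases "D \<subseteq> pverts G")
  case sub: True
  then have fin: "finite D" using pair_finite_verts finite_subset by blast
  show ?thesis
  proof
    assume dom: "dominating_set G D"
    have "D \<noteq> {}" using dom ne by (auto simp: dominating_set_def)
    moreover have "D \<noteq> {d}" for d
    proof
      assume D: "D = {d}"
      then obtain b where b: "b \<in> pverts G" "closed_nbhd G d = pverts G - {b}"
        using unique sub by (auto simp: unique_non_neighbours_def)
      \<comment> \<open>A single vertex fails to dominate its own non-neighbour.\<close>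
      have "b \<notin> closed_nbhd G d" using b by blast
      then have "d \<notin> closed_nbhd G b" using closed_nbhd_sym by blast
      then show False using dom b D by (auto simp: dominating_set_iff_closed_nbhd)
    qed
    ultimately have "card D \<noteq> 0" "card D \<noteq> 1"
      using fin by (auto simp: card_1_singleton_iff)
    then show "D \<subseteq> pverts G \<and> card D \<ge> 2" using sub by simp
  next
    assume card: "D \<subseteq> pverts G \<and> card D \<ge> 2"
    have "closed_nbhd G v \<inter> D \<noteq> {}" if v: "v \<in> pverts G" for v
    proof
      assume disj: "closed_nbhd G v \<inter> D = {}"
      obtain b where "closed_nbhd G v = pverts G - {b}"
        using unique v unfolding unique_non_neighbours_def by blast
      \<comment> \<open>Each \<open>v\<close> misses only one vertex, so two vertices cannot both
        avoid its closed neighbourhood.\<close>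
      then have "D \<subseteq> {b}" using disj sub by blast
      then show False using card card_mono[of "{b}" D] by simp
    qed
    then show "dominating_set G D" using sub by (simp add: dominating_set_iff_closed_nbhd)
  qed
qed (simp add: dominating_set_def)

text \<open>Deleting a vertex destroys domination only if it leaves fewer than two vertices, so
  there are either two critical vertices or none.\<close>

lemma even_critical_if_unique_non_neighbours:
  assumes "unique_non_neighbours G" "pverts G \<noteq> {}" "dominating_set G D"
  shows "even (card (critical G D))"
proof -
  note iff = dominating_set_iff_card_ge_2[OF assms(1,2)]
  have D: "D \<subseteq> pverts G" "card D \<ge> 2" using assms(3) iff by auto
  then have "finite D" using pair_finite_verts finite_subset by blast
  then have "critical G D = (if card D = 2 then D else {})"
    using D by (auto simp: critical_def iff card_Diff_singleton)
  then show ?thesis by simp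
qed

section \<open>Recognising the cocktail party graph\<close>

lemma cocktail_party_graph_iff:
  "cocktail_party_graph n G \<longleftrightarrow>
     even n \<and> n \<ge> 4 \<and> card (pverts G) = n \<and> unique_non_neighbours G"
proof
  assume cp: "cocktail_party_graph n G"
  then obtain K :: "nat pair_pre_digraph" and M f where
    K: "complete_digraph n (with_proj K)" and M: "perfect_matching K M"
    and f: "pre_digraph.digraph_isomorphism
      (with_proj \<lparr> pverts = pverts K, parcs = parcs K - M \<rparr>) f"
    and G_eq: "with_proj G = app_iso f (with_proj \<lparr> pverts = pverts K, parcs = parcs K - M \<rparr>)"
    by (auto simp: cocktail_party_graph_def digraph_iso_def)
  define g where "g = iso_verts f"
  have Kn: "card (pverts K) = n"
    and Karcs: "parcs K = {(u, v). (u, v) \<in> pverts K \<times> pverts K \<and> u \<noteq> v}"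
    using K by (auto simp: complete_digraph_pair_def)
  have verts: "pverts G = g ` pverts K"
    using arg_cong[OF G_eq, of verts] by (simp add: g_def)
  have arcs: "parcs G = iso_arcs f ` (parcs K - M)"
    using arg_cong[OF G_eq, of arcs] by simp
  \<comment> \<open>The ends of arcs in \<open>G\<close> are given by \<open>fst\<close> and
    \<open>snd\<close>, which forces the arc map to act as \<open>g\<close> on both ends.\<close>
  have "iso_tail f = fst" "iso_head f = snd"
    using arg_cong[OF G_eq, of tail] arg_cong[OF G_eq, of head] by simp_all
  then have inj: "inj_on g (pverts K)"
    and ends: "\<forall>e \<in> parcs K - M. iso_arcs f e = map_prod g g e"
    using f by (auto simp: pre_digraph.digraph_isomorphism_def g_def prod_eq_iff)
  have arcs: "parcs G = map_prod g g ` (parcs K - M)"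
    using ends unfolding arcs by (intro image_cong) auto
  have "unique_non_neighbours G"
    unfolding unique_non_neighbours_def verts
  proof clarify
    fix i assume i: "i \<in> pverts K"
    \<comment> \<open>The partner of \<open>i\<close> in the matching becomes the non-neighbour of
      \<open>g i\<close>.\<close>
    then obtain j where j_iff: "\<And>k. (i, k) \<in> M \<longleftrightarrow> k = j"
      using M unfolding perfect_matching_def by metis
    have "(i, j) \<in> parcs K"
      using M j_iff unfolding perfect_matching_def by blast
    then have jK: "j \<in> pverts K" "i \<noteq> j"
      using Karcs by auto
    have "(g i, g k) \<in> parcs G \<longleftrightarrow> k \<noteq> i \<and> k \<noteq> j" if k: "k \<in> pverts K" for k
    proof -
      have "(g i, g k) \<in> parcs G \<longleftrightarrow> map_prod g g (i, k) \<in> map_prod g g ` (parcs K - M)"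
        by (simp add: arcs)
      also have "\<dots> \<longleftrightarrow> (i, k) \<in> parcs K - M"
        by (rule inj_on_image_mem_iff[OF map_prod_inj_on[OF inj inj]]) (use i k Karcs in auto)
      also have "\<dots> \<longleftrightarrow> k \<noteq> i \<and> k \<noteq> j"
        using i k j_iff[of k] Karcs by auto
      finally show ?thesis .
    qed
    moreover have "(g i, y) \<in> parcs G \<Longrightarrow> y \<in> g ` pverts K" for y
      using in_arcsD2 verts by blast
    ultimately have "closed_nbhd G (g i) = g ` pverts K - {g j}"
      using i jK inj by (auto simp: closed_nbhd_def inj_on_eq_iff)
    then show "\<exists>b \<in> g ` pverts K. closed_nbhd G (g i) = g ` pverts K - {b}"
      using jK by blast
  qed
  moreover have "card (pverts G) = n"
    using verts inj Kn by (simp add: card_image)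
  ultimately show "even n \<and> n \<ge> 4 \<and> card (pverts G) = n \<and> unique_non_neighbours G"
    using cp by (simp add: cocktail_party_graph_def)
next
  assume R: "even n \<and> n \<ge> 4 \<and> card (pverts G) = n \<and> unique_non_neighbours G"
  then obtain f where f: "bij_betw f {..<n} (pverts G)"
    using ex_bij_betw_nat_finite[OF pair_finite_verts] by (auto simp: atLeast0LessThan)
  then have inj: "inj_on f {..<n}" and verts: "pverts G = f ` {..<n}"
    by (auto simp: bij_betw_def)
  define K :: "nat pair_pre_digraph" where
    "K = \<lparr> pverts = {..<n}, parcs = {(u, v). (u, v) \<in> {..<n} \<times> {..<n} \<and> u \<noteq> v} \<rparr>"
  \<comment> \<open>Numbering the vertices of \<open>G\<close> by \<open>f\<close>, the matching to
    remove consists of the pulled-back non-edges.\<close>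
  define M where "M = {(i, j). (i, j) \<in> parcs K \<and> (f i, f j) \<notin> parcs G}"
  define H where "H = \<lparr> pverts = pverts K, parcs = parcs K - M \<rparr>"
  define h where "h = \<lparr> iso_verts = f, iso_arcs = map_prod f f,
    iso_head = (snd :: 'a \<times> 'a \<Rightarrow> 'a), iso_tail = fst \<rparr>"
  have "complete_digraph n (with_proj K)"
    unfolding complete_digraph_pair_def by (simp add: K_def)
  moreover have "perfect_matching K M"
    unfolding perfect_matching_def
  proof (intro conjI ballI)
    show "M \<subseteq> parcs K" by (auto simp: M_def)
    show "sym M" using arcs_symmetric by (auto simp: M_def K_def intro!: symI)
    fix i assume "i \<in> pverts K"
    then have i: "i < n" by (simp add: K_def)
    then have "f i \<in> pverts G" by (simp add: verts)
    then obtain b where "b \<in> pverts G" "closed_nbhd G (f i) = pverts G - {b}"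
      using R unfolding unique_non_neighbours_def by blast
    then obtain j where j: "j < n" "closed_nbhd G (f i) = pverts G - {f j}"
      using verts by auto
    have "(i, k) \<in> M \<longleftrightarrow> k = j" for k
    proof (cases "k < n")
      case True
      then have "(i, k) \<in> M \<longleftrightarrow> f k \<notin> closed_nbhd G (f i)"
        using i inj by (auto simp: M_def K_def closed_nbhd_def inj_on_eq_iff)
      also have "\<dots> \<longleftrightarrow> k = j"
        using True j verts inj by (auto simp: inj_on_eq_iff)
      finally show ?thesis .
    qed (use j in \<open>auto simp: M_def K_def\<close>)
    then show "\<exists>!k. (i, k) \<in> M" by simp
  qed
  moreover have "digraph_iso (with_proj H) (with_proj G)"
    unfolding digraph_iso_def
  proof (intro exI conjI)
    have "wf_digraph (with_proj H)"
      by unfold_locales (auto simp: H_def K_def)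
    moreover have "inj_on (map_prod f f) (parcs H)"
      by (rule inj_on_subset[OF map_prod_inj_on[OF inj inj]]) (auto simp: H_def K_def)
    ultimately show "pre_digraph.digraph_isomorphism (with_proj H) h"
      using inj by (auto simp: pre_digraph.digraph_isomorphism_def h_def H_def K_def)
    have "parcs G = map_prod f f ` (parcs K - M)"
    proof (intro equalityI subrelI)
      fix a b assume ab: "(a, b) \<in> parcs G"
      then have "a \<in> f ` {..<n}" "b \<in> f ` {..<n}" "a \<noteq> b"
        using in_arcsD1 in_arcsD2 verts no_loops' by blast+
      then obtain i j where "i < n" "j < n" "i \<noteq> j" "a = f i" "b = f j" by auto
      with ab show "(a, b) \<in> map_prod f f ` (parcs K - M)"
        by (intro image_eqI[of _ _ "(i, j)"]) (auto simp: K_def M_def)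
    qed (auto simp: M_def)
    then show "with_proj G = app_iso h (with_proj H)"
      by (intro pre_digraph.equality) (simp_all add: h_def H_def verts K_def)
  qed
  ultimately show "cocktail_party_graph n G"
    using R unfolding cocktail_party_graph_def H_def by blast
qed

text \<open>Evenness leaves only order two to exclude; there the missing vertex is the only possible
  neighbour, so each vertex would be isolated.\<close>

lemma card_ge_4_if_unique_non_neighbours:
  assumes conn: "connected (with_proj G)" and "unique_non_neighbours G"
    and "even (card (pverts G))" "card (pverts G) \<ge> 2"
  shows "card (pverts G) \<ge> 4"
proof (rule ccontr)
  assume "\<not> card (pverts G) \<ge> 4"
  with assms have card: "card (pverts G) = 2" by presburger
  then obtain a where a: "a \<in> pverts G" by fastforce
  then obtain b where b: "b \<in> pverts G" "closed_nbhd G a = pverts G - {b}"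
    using assms(2) by (auto simp: unique_non_neighbours_def)
  then have "card (closed_nbhd G a) = 1"
    using card by (simp add: card_Diff_singleton)
  then have "closed_nbhd G a = {a}"
    by (metis card_1_singletonE self_in_closed_nbhd singletonD)
  then show False
    using connected_imp_closed_nbhd_ne_singleton[OF conn assms(4) a] by simp
qed

end

theorem theorem7:
  fixes G :: "'a pair_pre_digraph" and n :: nat
  assumes "pair_graph G"
    and "connected (with_proj G)"
    and "card (pverts G) = n"
    and "n \<ge> 2"
  shows "eulerian (with_proj (dominating_graph G)) \<longleftrightarrow>
           even n \<and> n \<ge> 4 \<and> cocktail_party_graph n G"
proof -
  interpret pair_graph G by (rule assms)
  show ?thesis
  proof
    assume "eulerian (with_proj (dominating_graph G))"
    then have parity: "\<And>D. dominating_set G D \<Longrightarrow> even (card (critical G D)) \<longleftrightarrow> even n"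
      using assms(3) by (simp add: eulerian_dominating_graph_iff)
    have "even n"
      using parity[OF dominating_set_verts] critical_verts_eq_empty assms by simp
    moreover from this have "unique_non_neighbours G"
      using unique_non_neighbours_if_even_critical[OF assms(2)] parity by simp
    ultimately show "even n \<and> n \<ge> 4 \<and> cocktail_party_graph n G"
      using card_ge_4_if_unique_non_neighbours assms by (simp add: cocktail_party_graph_iff)
  next
    assume "even n \<and> n \<ge> 4 \<and> cocktail_party_graph n G"
    moreover have "pverts G \<noteq> {}" using assms by auto
    ultimately show "eulerian (with_proj (dominating_graph G))"
      using even_critical_if_unique_non_neighbours
      by (simp add: cocktail_party_graph_iff eulerian_dominating_graph_iff)
  qed
qed

end
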